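(* Let $(W,S)$ be a Coxeter system with $S$ finite. The partially ordered set $(\mathscr{P}_{\mathrm{reg}}(W),\leq)$ of all regular partitions of $W$ is a complete lattice (every nonempty subset has both a meet and a join), with bottom element the cone type partition $\mathscr{T}$ and top element $\mathbf{1}=\{\{w\}\mid w\in W\}$.
   Context: $\ell$ is the length function and $D_L(w)=\{s\in S\mid \ell(sw)=\ell(w)-1\}$. A partition of $W$ is a set of nonempty pairwise disjoint subsets (parts) with union $W$. A partition $\mathscr{P}$ is regular if: (1) for each part $P$, $D_L(x)=D_L(y)$ for all $x,y\in P$ (common value $D_L(P)$); and (2) if $P\in\mathscr{P}$ and $s\in S\setminus D_L(P)$ then $sP\subseteq P'$ for some part $P'\in\mathscr{P}$. The order is: $\mathscr{P}\leq\mathscr{P}'$ if $\mathscr{P}'$ is a refinement of $\mathscr{P}$, i.e. each part of $\mathscr{P}'$ is contained in a part of $\mathscr{P}$ (dual to the usual convention). The cone type of $x\in W$ is $T(x)=\{y\in W\mid \ell(xy)=\ell(x)+\ell(y)\}$. The cone type partition $\mathscr{T}$ is the partition of $W$ with parts $X_T=\{w\in W\mid T(w^{-1})=T\}$, for $T$ ranging over all cone types; that is, $x,y$ lie in the same part iff $T(x^{-1})=T(y^{-1})$. *)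

theory Defs
  imports
    "HOL-Algebra.Algebra"
    "HOL-Library.Disjoint_Sets"
    "HOL-Library.Extended_Nat"
begin

text \<open>The letter \<open>(s, True)\<close> stands for the generator \<open>s\<close> and \<open>(s, False)\<close> for its formal
  inverse. Two words over \<open>S\<close> are related by \<open>presentation_eq S R\<close> iff they represent the same
  element of the group \<open>\<langle>S | R\<rangle>\<close>.\<close>

type_synonym 'a word = "('a \<times> bool) list"

definition words :: "'a set \<Rightarrow> 'a word set" where
  "words S = lists (S \<times> UNIV)"

inductive presentation_eq :: "'a set \<Rightarrow> 'a word set \<Rightarrow> 'a word \<Rightarrow> 'a word \<Rightarrow> bool"
  for S R where
  refl: "u \<in> words S \<Longrightarrow> presentation_eq S R u u"
| sym: "presentation_eq S R u v \<Longrightarrow> presentation_eq S R v u"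
| trans: "presentation_eq S R u v \<Longrightarrow> presentation_eq S R v w \<Longrightarrow> presentation_eq S R u w"
| cancel: "u \<in> words S \<Longrightarrow> v \<in> words S \<Longrightarrow> s \<in> S \<Longrightarrow>
    presentation_eq S R (u @ [(s, b), (s, \<not> b)] @ v) (u @ v)"
| relator: "u \<in> words S \<Longrightarrow> v \<in> words S \<Longrightarrow> r \<in> R \<Longrightarrow>
    presentation_eq S R (u @ r @ v) (u @ v)"

fun word_value :: "('a, 'b) monoid_scheme \<Rightarrow> 'a word \<Rightarrow> 'a" where
  "word_value G [] = \<one>\<^bsub>G\<^esub>"
| "word_value G ((s, b) # u) = (if b then s else inv\<^bsub>G\<^esub> s) \<otimes>\<^bsub>G\<^esub> word_value G u"

text \<open>The canonical map from \<open>\<langle>S | R\<rangle>\<close> to \<open>G\<close> is well defined and bijective.\<close>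

definition has_presentation :: "('a, 'b) monoid_scheme \<Rightarrow> 'a set \<Rightarrow> 'a word set \<Rightarrow> bool" where
  "has_presentation G S R \<longleftrightarrow>
     group G \<and> S \<subseteq> carrier G \<and> R \<subseteq> words S \<and> generate G S = carrier G \<and>
     (\<forall>u\<in>words S. \<forall>v\<in>words S. word_value G u = word_value G v \<longleftrightarrow> presentation_eq S R u v)"

definition coxeter_matrix :: "'a set \<Rightarrow> ('a \<Rightarrow> 'a \<Rightarrow> enat) \<Rightarrow> bool" where
  "coxeter_matrix S m \<longleftrightarrow>
     (\<forall>s\<in>S. m s s = 1) \<and>
     (\<forall>s\<in>S. \<forall>t\<in>S. m s t = m t s \<and> (s \<noteq> t \<longrightarrow> 2 \<le> m s t))"

text \<open>The relators are \<open>(st)^m(s,t)\<close>, including \<open>s^2\<close>; there is none when \<open>m(s,t)\<close> is infinite.\<close>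

definition coxeter_relators :: "'a set \<Rightarrow> ('a \<Rightarrow> 'a \<Rightarrow> enat) \<Rightarrow> 'a word set" where
  "coxeter_relators S m =
     {concat (replicate k [(s, True), (t, True)]) | s t k. s \<in> S \<and> t \<in> S \<and> m s t = enat k}"

definition coxeter_system :: "('a, 'b) monoid_scheme \<Rightarrow> 'a set \<Rightarrow> bool" where
  "coxeter_system W S \<longleftrightarrow>
     (\<exists>m. coxeter_matrix S m \<and> has_presentation W S (coxeter_relators S m))"

definition cox_length :: "('a, 'b) monoid_scheme \<Rightarrow> 'a set \<Rightarrow> 'a \<Rightarrow> nat" where
  "cox_length W S w =
     (LEAST n. \<exists>ss. length ss = n \<and> set ss \<subseteq> S \<and> foldr (\<lambda>s x. s \<otimes>\<^bsub>W\<^esub> x) ss \<one>\<^bsub>W\<^esub> = w)"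

definition left_descents :: "('a, 'b) monoid_scheme \<Rightarrow> 'a set \<Rightarrow> 'a \<Rightarrow> 'a set" where
  "left_descents W S w =
     {s \<in> S. int (cox_length W S (s \<otimes>\<^bsub>W\<^esub> w)) = int (cox_length W S w) - 1}"

text \<open>In the second condition \<open>left_descents W S x\<close>, for any \<open>x \<in> P\<close>, is the common left descent
  set of \<open>P\<close> provided by the first condition.\<close>

definition regular_partition :: "('a, 'b) monoid_scheme \<Rightarrow> 'a set \<Rightarrow> 'a set set \<Rightarrow> bool" where
  "regular_partition W S \<P> \<longleftrightarrow>
     partition_on (carrier W) \<P> \<and>
     (\<forall>P\<in>\<P>. \<forall>x\<in>P. \<forall>y\<in>P. left_descents W S x = left_descents W S y) \<and>
     (\<forall>P\<in>\<P>. \<forall>x\<in>P. \<forall>s\<in>S - left_descents W S x. \<exists>P'\<in>\<P>. s <#\<^bsub>W\<^esub> P \<subseteq> P')"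

text \<open>\<open>refines A P Q\<close> says that \<open>P\<close> is finer than \<open>Q\<close>; the order is such that finer partitions
  are larger.\<close>

definition regular_partitions :: "('a, 'b) monoid_scheme \<Rightarrow> 'a set \<Rightarrow> 'a set set gorder" where
  "regular_partitions W S =
     \<lparr>carrier = {\<P>. regular_partition W S \<P>}, eq = (=),
      le = (\<lambda>\<P> \<P>'. refines (carrier W) \<P>' \<P>)\<rparr>"

definition cone_type :: "('a, 'b) monoid_scheme \<Rightarrow> 'a set \<Rightarrow> 'a \<Rightarrow> 'a set" where
  "cone_type W S x =
     {y \<in> carrier W. cox_length W S (x \<otimes>\<^bsub>W\<^esub> y) = cox_length W S x + cox_length W S y}"

definition cone_type_partition :: "('a, 'b) monoid_scheme \<Rightarrow> 'a set \<Rightarrow> 'a set set" where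
  "cone_type_partition W S =
     (\<lambda>T. {w \<in> carrier W. cone_type W S (inv\<^bsub>W\<^esub> w) = T}) ` (cone_type W S ` carrier W)"

definition singleton_partition :: "('a, 'b) monoid_scheme \<Rightarrow> 'a set set" where
  "singleton_partition W = {{w} | w. w \<in> carrier W}"

end

theory Submission
  imports Defs
begin

text \<open>All relators of a Coxeter presentation have even length, so the parity of the length is
  well defined and \<open>\<ell>(sw) = \<ell>(w) \<plusminus> 1\<close>. Hence \<open>s \<notin> D\<^sub>L(w)\<close> iff \<open>s \<in> T(w\<^sup>-\<^sup>1)\<close>, and in
  that case \<open>T((sw)\<^sup>-\<^sup>1) = {z. \<ell>(sz) = \<ell>(z) + 1 \<and> sz \<in> T(w\<^sup>-\<^sup>1)}\<close> is determined by \<open>T(w\<^sup>-\<^sup>1)\<close>; so the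
  cone type partition is regular. Conversely, if \<open>x\<close> and \<open>y\<close> lie in a common part of a regular
  partition, then peeling off the first letter of \<open>z = sz'\<close> shows by induction on \<open>\<ell>(z)\<close> that
  \<open>z \<in> T(x\<^sup>-\<^sup>1)\<close> iff \<open>z \<in> T(y\<^sup>-\<^sup>1)\<close>, since \<open>sx\<close> and \<open>sy\<close> again share a part. Common refinements of
  regular partitions are regular, which together with a bottom element gives a complete lattice.\<close>

section \<open>Parity of words in a Coxeter presentation\<close>

lemma presentation_eq_even_length:
  assumes "presentation_eq S R u v" and "\<And>r. r \<in> R \<Longrightarrow> even (length r)"
  shows "even (length u) \<longleftrightarrow> even (length v)"
  using assms(1)
proof induction
  case (relator u v r)
  then show ?case using assms(2)[of r] by simp
qed auto

lemma even_length_coxeter_relators: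
  "r \<in> coxeter_relators S m \<Longrightarrow> even (length r)"
  by (auto simp: coxeter_relators_def length_concat sum_list_replicate)

section \<open>The conditions in regularity\<close>

lemma regular_partition_D1: "regular_partition W S \<P> \<Longrightarrow> partition_on (carrier W) \<P>"
  by (simp add: regular_partition_def)

lemma regular_partition_D2:
  assumes "regular_partition W S \<P>" "P \<in> \<P>" "x \<in> P" "y \<in> P"
  shows "left_descents W S x = left_descents W S y"
  using assms unfolding regular_partition_def by blast

lemma regular_partition_D3:
  assumes "regular_partition W S \<P>" "P \<in> \<P>" "x \<in> P" "s \<in> S" "s \<notin> left_descents W S x"
  obtains Q where "Q \<in> \<P>" "s <#\<^bsub>W\<^esub> P \<subseteq> Q"
  using assms unfolding regular_partition_def by (meson DiffI)

section \<open>Generators and the words in them\<close>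

locale coxeter_group = group W for W (structure) +
  fixes S :: "'a set"
  assumes coxeter: "coxeter_system W S"
begin

abbreviation len :: "'a \<Rightarrow> nat" (\<open>\<ell>\<close>) where "len \<equiv> cox_length W S"
abbreviation desc :: "'a \<Rightarrow> 'a set" where "desc \<equiv> left_descents W S"
abbreviation cone :: "'a \<Rightarrow> 'a set" where "cone \<equiv> cone_type W S"
abbreviation val :: "'a list \<Rightarrow> 'a" where "val ss \<equiv> foldr (\<otimes>) ss \<one>"

lemma generators_closed [simp, intro]: "s \<in> S \<Longrightarrow> s \<in> carrier W"
  using coxeter by (auto simp: coxeter_system_def has_presentation_def)

lemma generator_square:
  assumes "s \<in> S"
  shows "s \<otimes> s = \<one>"
proof -
  obtain m where m: "coxeter_matrix S m" "has_presentation W S (coxeter_relators S m)"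
    using coxeter by (auto simp: coxeter_system_def)
  \<comment> \<open>This is the relator \<open>(st)^k\<close> for \<open>t = s\<close> and
    \<open>k = 1\<close>, given by the diagonal entry \<open>m s s = 1\<close>.\<close>
  let ?r = "[(s, True), (s, True)]"
  have "m s s = enat 1"
    using m(1) assms by (simp add: coxeter_matrix_def one_enat_def)
  then have "?r \<in> coxeter_relators S m"
    using assms by (auto simp: coxeter_relators_def intro!: exI[of _ s] exI[of _ "1::nat"])
  then have "presentation_eq S (coxeter_relators S m) ([] @ ?r @ []) ([] @ [])"
    by (intro presentation_eq.relator) (auto simp: words_def)
  moreover have "?r \<in> words S" "[] \<in> words S"
    using assms by (auto simp: words_def)
  ultimately have "word_value W ?r = word_value W []"
    using m(2) unfolding has_presentation_def by (metis append_Nil append_Nil2)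
  then show ?thesis using assms by simp
qed

lemma inv_generator [simp]: "s \<in> S \<Longrightarrow> inv s = s"
  by (simp add: generator_square inv_equality)

lemma generator_cancel [simp]:
  assumes "s \<in> S" "w \<in> carrier W"
  shows "s \<otimes> (s \<otimes> w) = w"
  using assms by (simp add: m_assoc[symmetric] generator_square)

lemma val_closed [simp]: "set ss \<subseteq> S \<Longrightarrow> val ss \<in> carrier W"
  by (induction ss) auto

lemma val_append:
  "set ss \<subseteq> S \<Longrightarrow> set ts \<subseteq> S \<Longrightarrow> val (ss @ ts) = val ss \<otimes> val ts"
  by (induction ss) (auto simp: m_assoc)

lemma val_rev: "set ss \<subseteq> S \<Longrightarrow> val (rev ss) = inv (val ss)"
proof (induction ss)
  case (Cons s ss)
  have "val (rev ss @ [s]) = val (rev ss) \<otimes> val [s]"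
    using Cons.prems by (intro val_append) auto
  then show ?case using Cons by (simp add: inv_mult_group)
qed simp

text \<open>Generators are their own inverses, so words without formal inverses already exhaust the
  generated group.\<close>

lemma ex_word: "w \<in> carrier W \<Longrightarrow> \<exists>ss. set ss \<subseteq> S \<and> val ss = w"
proof -
  assume "w \<in> carrier W"
  then have "w \<in> generate W S"
    using coxeter by (auto simp: coxeter_system_def has_presentation_def)
  then show ?thesis
  proof induction
    case one
    show ?case by (intro exI[of _ "[]"]) simp
  next
    case (incl h)
    then show ?case by (intro exI[of _ "[h]"]) simp
  next
    case (inv h)
    then show ?case by (intro exI[of _ "[h]"]) simp
  next
    case (eng g h)
    then obtain ss ts where "set ss \<subseteq> S" "val ss = g" "set ts \<subseteq> S" "val ts = h"
      by blast
    then show ?case by (intro exI[of _ "ss @ ts"]) (simp add: val_append del: foldr_append)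
  qed
qed

section \<open>The length function\<close>

lemma len_val_le: "set ss \<subseteq> S \<Longrightarrow> \<ell> (val ss) \<le> length ss"
  unfolding cox_length_def by (rule Least_le) blast

lemma reduced_word:
  assumes "w \<in> carrier W"
  obtains ss where "set ss \<subseteq> S" "val ss = w" "length ss = \<ell> w"
proof -
  have "\<exists>n ss. length ss = n \<and> set ss \<subseteq> S \<and> val ss = w"
    using ex_word[OF assms] by blast
  from LeastI_ex[OF this] show thesis
    using that unfolding cox_length_def by blast
qed

lemma len_mult_le:
  assumes "x \<in> carrier W" "y \<in> carrier W"
  shows "\<ell> (x \<otimes> y) \<le> \<ell> x + \<ell> y"
proof -
  obtain ss where ss: "set ss \<subseteq> S" "val ss = x" "length ss = \<ell> x"
    using reduced_word assms(1) by blast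
  obtain ts where ts: "set ts \<subseteq> S" "val ts = y" "length ts = \<ell> y"
    using reduced_word assms(2) by blast
  show ?thesis
    using len_val_le[of "ss @ ts"] ss ts by (simp add: val_append del: foldr_append)
qed

lemma len_inv_le: "x \<in> carrier W \<Longrightarrow> \<ell> (inv x) \<le> \<ell> x"
  by (metis reduced_word len_val_le val_rev length_rev set_rev)

lemma len_inv [simp]: "x \<in> carrier W \<Longrightarrow> \<ell> (inv x) = \<ell> x"
  using len_inv_le[of x] len_inv_le[of "inv x"] by simp

lemma len_one [simp]: "\<ell> \<one> = 0"
  using len_val_le[of "[]"] by simp

lemma len_generator_le: "s \<in> S \<Longrightarrow> \<ell> s \<le> 1"
  using len_val_le[of "[s]"] by simp

text \<open>Read as words with all letters positive, \<open>ss\<close> and \<open>ts\<close>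
  represent the same element, so they are linked by moves that preserve parity.\<close>

lemma even_length_val:
  assumes "set ss \<subseteq> S" "set ts \<subseteq> S" "val ss = val ts"
  shows "even (length ss) \<longleftrightarrow> even (length ts)"
proof -
  obtain m where m: "has_presentation W S (coxeter_relators S m)"
    using coxeter by (auto simp: coxeter_system_def)
  let ?word = "map (\<lambda>s. (s, True))"
  have val: "word_value W (?word us) = val us" for us
    by (induction us) auto
  have "?word ss \<in> words S" "?word ts \<in> words S"
    using assms by (auto simp: words_def)
  then have "presentation_eq S (coxeter_relators S m) (?word ss) (?word ts)"
    using m assms(3) unfolding has_presentation_def by (metis val)
  from presentation_eq_even_length[OF this even_length_coxeter_relators] show ?thesis
    by simp
qed

lemma even_len_generator_mult:
  assumes "s \<in> S" "w \<in> carrier W"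
  shows "even (\<ell> (s \<otimes> w)) \<longleftrightarrow> odd (\<ell> w)"
proof -
  obtain ss where ss: "set ss \<subseteq> S" "val ss = w" "length ss = \<ell> w"
    using reduced_word assms(2) by blast
  obtain ts where ts: "set ts \<subseteq> S" "val ts = s \<otimes> w" "length ts = \<ell> (s \<otimes> w)"
    using reduced_word[of "s \<otimes> w"] assms by blast
  show ?thesis
    using even_length_val[of "s # ss" ts] ss ts assms by simp
qed

text \<open>Subadditivity leaves a difference of at most one, and parity excludes equal
  lengths.\<close>

lemma len_generator_mult_cases:
  assumes "s \<in> S" "w \<in> carrier W"
  shows "\<ell> (s \<otimes> w) = \<ell> w + 1 \<or> \<ell> w = \<ell> (s \<otimes> w) + 1"
proof -
  have "\<ell> (s \<otimes> w) \<le> \<ell> w + 1"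
    using len_mult_le[of s w] len_generator_le[of s] assms by fastforce
  \<comment> \<open>Here subadditivity is applied to
    \<open>w = s \<otimes> (s \<otimes> w)\<close>.\<close>
  moreover have "\<ell> w \<le> \<ell> (s \<otimes> w) + 1"
    using len_mult_le[of s "s \<otimes> w"] len_generator_le[of s] assms by fastforce
  ultimately show ?thesis
    using even_len_generator_mult[OF assms] by presburger
qed

lemma len_generator: "s \<in> S \<Longrightarrow> \<ell> s = 1"
  using len_generator_mult_cases[of s \<one>] by simp

section \<open>Left descents and cone types\<close>

lemma not_desc_iff:
  assumes "s \<in> S" "w \<in> carrier W"
  shows "s \<notin> desc w \<longleftrightarrow> \<ell> (s \<otimes> w) = \<ell> w + 1"
  using len_generator_mult_cases[OF assms] assms(1) by (auto simp: left_descents_def)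

lemma mem_cone_inv:
  assumes "x \<in> carrier W"
  shows "z \<in> cone (inv x) \<longleftrightarrow> z \<in> carrier W \<and> \<ell> (inv x \<otimes> z) = \<ell> x + \<ell> z"
  using assms by (simp add: cone_type_def)

text \<open>Length is invariant under inversion, and \<open>inv x \<otimes> s\<close> is the inverse
  of \<open>s \<otimes> x\<close>. Hence left descents of \<open>x\<close> can be read off the cone
  type of \<open>inv x\<close>.\<close>

lemma generator_in_cone_iff:
  assumes "s \<in> S" "x \<in> carrier W"
  shows "s \<in> cone (inv x) \<longleftrightarrow> s \<notin> desc x"
proof -
  have "inv x \<otimes> s = inv (s \<otimes> x)"
    using assms by (simp add: inv_mult_group)
  then have "\<ell> (inv x \<otimes> s) = \<ell> (s \<otimes> x)"
    using assms by simp
  then show ?thesis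
    using assms by (simp add: mem_cone_inv not_desc_iff len_generator)
qed

lemma desc_eq_of_cone_eq:
  assumes "x \<in> carrier W" "y \<in> carrier W" "cone (inv x) = cone (inv y)"
  shows "desc x = desc y"
proof -
  have "desc x \<subseteq> S" "desc y \<subseteq> S"
    by (auto simp: left_descents_def)
  then show ?thesis
    using generator_in_cone_iff assms by blast
qed

text \<open>Both sides concern the length of the same element
  \<open>inv x \<otimes> (s \<otimes> z)\<close>. The right-hand side depends on \<open>x\<close>
  only through its inverse's cone type, and it also drives the induction for regular
  partitions.\<close>

lemma mem_cone_inv_generator_mult:
  assumes "s \<in> S" "x \<in> carrier W" "s \<notin> desc x" "z \<in> carrier W"
  shows "z \<in> cone (inv (s \<otimes> x)) \<longleftrightarrow> \<ell> (s \<otimes> z) = \<ell> z + 1 \<and> s \<otimes> z \<in> cone (inv x)"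
proof -
  have "inv (s \<otimes> x) \<otimes> z = inv x \<otimes> (s \<otimes> z)"
    using assms by (simp add: inv_mult_group m_assoc)
  then have "z \<in> cone (inv (s \<otimes> x)) \<longleftrightarrow> \<ell> (inv x \<otimes> (s \<otimes> z)) = \<ell> x + 1 + \<ell> z"
    using assms not_desc_iff[of s x] mem_cone_inv[of "s \<otimes> x" z] by simp
  moreover have "s \<otimes> z \<in> cone (inv x) \<longleftrightarrow> \<ell> (inv x \<otimes> (s \<otimes> z)) = \<ell> x + \<ell> (s \<otimes> z)"
    using assms mem_cone_inv[of x "s \<otimes> z"] by simp
  \<comment> \<open>If multiplication by \<open>s\<close> shortened \<open>z\<close>, this bound
    would keep the length below \<open>\<ell> x + 1 + \<ell> z\<close>; so membership forces
    \<open>s \<otimes> z\<close> to be longer than \<open>z\<close>.\<close>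
  moreover have "\<ell> (inv x \<otimes> (s \<otimes> z)) \<le> \<ell> x + \<ell> (s \<otimes> z)"
    using len_mult_le[of "inv x" "s \<otimes> z"] assms by simp
  ultimately show ?thesis
    using len_generator_mult_cases[OF assms(1,4)] by linarith
qed

lemma cone_inv_generator_mult_cong:
  assumes "x \<in> carrier W" "y \<in> carrier W" "cone (inv x) = cone (inv y)"
    and "s \<in> S" "s \<notin> desc x"
  shows "cone (inv (s \<otimes> x)) = cone (inv (s \<otimes> y))"
proof -
  have "s \<notin> desc y"
    using assms desc_eq_of_cone_eq by blast
  then have "z \<in> cone (inv (s \<otimes> x)) \<longleftrightarrow> z \<in> cone (inv (s \<otimes> y))" if "z \<in> carrier W" for z
    using assms that by (simp add: mem_cone_inv_generator_mult)
  then show ?thesis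
    by (auto simp: cone_type_def)
qed

section \<open>Cone types are constant on parts of regular partitions\<close>

lemma left_letter:
  assumes "z \<in> carrier W" "\<ell> z = Suc n"
  obtains s z' where "s \<in> S" "z' \<in> carrier W" "z = s \<otimes> z'" "\<ell> z' = n"
proof -
  obtain ss where ss: "set ss \<subseteq> S" "val ss = z" "length ss = Suc n"
    using reduced_word assms by metis
  then obtain s ts where ts: "ss = s # ts"
    by (cases ss) auto
  have "\<ell> (val ts) \<le> n"
    using len_val_le[of ts] ss ts by simp
  then have "\<ell> (val ts) = n"
    using len_generator_mult_cases[of s "val ts"] ss ts assms by auto
  then show thesis
    using that[of s "val ts"] ss ts by simp
qed

text \<open>One inclusion suffices, as \<open>x\<close> and \<open>y\<close> may be exchanged. The
  part \<open>P\<close> varies in the induction because \<open>s \<otimes> x\<close> and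
  \<open>s \<otimes> y\<close> may share a different part.\<close>

lemma cone_subset_of_regular:
  assumes reg: "regular_partition W S \<P>"
    and "P \<in> \<P>" "x \<in> P" "y \<in> P" "z \<in> cone (inv x)"
  shows "z \<in> cone (inv y)"
  using assms(2-)
proof (induction "\<ell> z" arbitrary: P x y z)
  case 0
  have part: "partition_on (carrier W) \<P>"
    using reg by (rule regular_partition_D1)
  have closed: "x \<in> carrier W" "y \<in> carrier W"
    using 0 partition_onD1[OF part] by auto
  have z: "z \<in> carrier W"
    using 0 closed by (simp add: mem_cone_inv)
  then obtain ss where "val ss = z" "length ss = \<ell> z"
    by (rule reduced_word)
  then have "z = \<one>"
    using 0 by simp
  then show ?case
    using closed by (simp add: mem_cone_inv)
next
  case (Suc n)
  have part: "partition_on (carrier W) \<P>"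
    using reg by (rule regular_partition_D1)
  have closed: "x \<in> carrier W" "y \<in> carrier W"
    using Suc.prems partition_onD1[OF part] by auto
  have "z \<in> carrier W"
    using Suc.prems closed by (simp add: mem_cone_inv)
  then obtain s z' where s: "s \<in> S" and z': "z' \<in> carrier W" "z = s \<otimes> z'" "\<ell> z' = n"
    using left_letter Suc.hyps(2) by metis
  \<comment> \<open>Cone types are closed under prefixes: additivity of length for
    \<open>inv x\<close> and \<open>s \<otimes> z'\<close> forces additivity for
    \<open>inv x\<close> and \<open>s\<close>.\<close>
  have "\<ell> ((inv x \<otimes> s) \<otimes> z') = \<ell> x + Suc n"
    using Suc.prems Suc.hyps(2) closed s z' by (simp add: mem_cone_inv m_assoc)
  then have "\<ell> x + Suc n \<le> \<ell> (inv x \<otimes> s) + n"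
    using len_mult_le[of "inv x \<otimes> s" z'] closed s z' by simp
  then have "\<ell> (inv x \<otimes> s) = \<ell> x + \<ell> s"
    using len_mult_le[of "inv x" s] closed s by (simp add: len_generator)
  then have "s \<in> cone (inv x)"
    using s closed by (simp add: mem_cone_inv)
  then have sx: "s \<notin> desc x"
    using generator_in_cone_iff s closed by blast
  then have sy: "s \<notin> desc y"
    using regular_partition_D2[OF reg] Suc.prems by blast
  obtain Q where "Q \<in> \<P>" "s <# P \<subseteq> Q"
    using regular_partition_D3[OF reg Suc.prems(1,2) s sx] .
  then have Q: "Q \<in> \<P>" "s \<otimes> x \<in> Q" "s \<otimes> y \<in> Q"
    using Suc.prems by (auto simp: l_coset_def)
  have "z' \<in> cone (inv (s \<otimes> x))"
    using mem_cone_inv_generator_mult[OF s closed(1) sx z'(1)] Suc.prems Suc.hyps(2) z' by simp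
  then have "z' \<in> cone (inv (s \<otimes> y))"
    using Suc.hyps(1) z'(3) Q by blast
  then show ?case
    using mem_cone_inv_generator_mult[OF s closed(2) sy z'(1)] z' by simp
qed

section \<open>The cone type partition\<close>

lemma cone_type_partition_alt_def:
  "cone_type_partition W S =
     (\<lambda>x. {w \<in> carrier W. cone (inv w) = cone (inv x)}) ` carrier W"
proof -
  \<comment> \<open>Inversion permutes the group, so every cone type is \<open>cone (inv x)\<close>
    for some \<open>x\<close>. The parts thus become equivalence classes of elements, visibly
    nonempty.\<close>
  have "(\<lambda>x. inv x) ` carrier W = carrier W"
    by (force simp: image_iff intro: bexI[of _ "inv x" for x])
  then have "cone ` carrier W = (\<lambda>x. cone (inv x)) ` carrier W"
    by (metis image_image)
  then show ?thesis
    by (simp add: cone_type_partition_def image_image)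
qed

lemma cone_type_partition_part:
  assumes "x \<in> carrier W"
  shows "{w \<in> carrier W. cone (inv w) = cone (inv x)} \<in> cone_type_partition W S"
  using assms by (simp add: cone_type_partition_alt_def)

lemma cone_type_partition_cases:
  assumes "P \<in> cone_type_partition W S"
  obtains x where "x \<in> carrier W" "P = {w \<in> carrier W. cone (inv w) = cone (inv x)}"
  using assms unfolding cone_type_partition_alt_def by (rule imageE)

lemma partition_on_cone_type_partition:
  "partition_on (carrier W) (cone_type_partition W S)"
proof (rule partition_onI)
  show "\<Union> (cone_type_partition W S) = carrier W"
    unfolding cone_type_partition_alt_def by blast
  show "{} \<notin> cone_type_partition W S"
    unfolding cone_type_partition_alt_def by blast
  show "disjnt P Q"
    if PQ: "P \<in> cone_type_partition W S" "Q \<in> cone_type_partition W S" "P \<noteq> Q" for P Q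
    using PQ(1)
  proof (rule cone_type_partition_cases)
    fix x assume P: "P = {w \<in> carrier W. cone (inv w) = cone (inv x)}"
    obtain y where Q: "Q = {w \<in> carrier W. cone (inv w) = cone (inv y)}"
      using PQ(2) by (rule cone_type_partition_cases)
    then have "cone (inv x) \<noteq> cone (inv y)"
      using P PQ(3) by metis
    then show ?thesis
      unfolding P Q disjnt_iff by simp
  qed
qed

lemma regular_cone_type_partition: "regular_partition W S (cone_type_partition W S)"
  unfolding regular_partition_def
proof (intro conjI ballI partition_on_cone_type_partition)
  fix P x y
  assume P: "P \<in> cone_type_partition W S" and xy: "x \<in> P" "y \<in> P"
  from P obtain u where "P = {w \<in> carrier W. cone (inv w) = cone (inv u)}"
    by (rule cone_type_partition_cases)
  then have "x \<in> carrier W" "y \<in> carrier W" "cone (inv x) = cone (inv y)"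
    using xy by simp_all
  then show "desc x = desc y"
    by (rule desc_eq_of_cone_eq)
next
  fix P x s
  assume P: "P \<in> cone_type_partition W S" and x: "x \<in> P" and s: "s \<in> S - desc x"
  from P obtain u where u: "P = {w \<in> carrier W. cone (inv w) = cone (inv u)}"
    by (rule cone_type_partition_cases)
  have xW: "x \<in> carrier W"
    using u x by simp
  \<comment> \<open>The part receiving \<open>s <# P\<close> is the class of
    \<open>s \<otimes> x\<close>.\<close>
  have "s \<otimes> y \<in> {w \<in> carrier W. cone (inv w) = cone (inv (s \<otimes> x))}" if "y \<in> P" for y
    using that u x s cone_inv_generator_mult_cong[of x y s] by simp
  then have "s <# P \<subseteq> {w \<in> carrier W. cone (inv w) = cone (inv (s \<otimes> x))}"
    unfolding l_coset_def by blast
  moreover have "s \<otimes> x \<in> carrier W"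
    using xW s by simp
  ultimately show "\<exists>Q\<in>cone_type_partition W S. s <# P \<subseteq> Q"
    using cone_type_partition_part by blast
qed

text \<open>A part is sent to the class of any of its elements. In the reversed order this makes the
  cone type partition a lower bound.\<close>

lemma regular_refines_cone_type_partition:
  assumes reg: "regular_partition W S \<P>"
  shows "refines (carrier W) \<P> (cone_type_partition W S)"
  unfolding refines_def
proof (intro conjI ballI partition_on_cone_type_partition)
  show part: "partition_on (carrier W) \<P>"
    using reg by (rule regular_partition_D1)
  fix P assume P: "P \<in> \<P>"
  then obtain x where x: "x \<in> P"
    using partition_onD3[OF part] by (cases "P = {}") auto
  \<comment> \<open>The inclusion of cones is used in both directions to get equality.\<close>
  have "P \<subseteq> {w \<in> carrier W. cone (inv w) = cone (inv x)}"
    using cone_subset_of_regular[OF reg P] x P partition_onD1[OF part] by blast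
  moreover have "x \<in> carrier W"
    using x P partition_onD1[OF part] by blast
  ultimately show "\<exists>Q\<in>cone_type_partition W S. P \<subseteq> Q"
    using cone_type_partition_part by blast
qed

section \<open>The singleton partition and common refinements\<close>

lemma partition_on_singleton_partition:
  "partition_on (carrier W) (singleton_partition W)"
  by (auto simp: singleton_partition_def partition_on_def disjoint_def)

lemma regular_singleton_partition: "regular_partition W S (singleton_partition W)"
  unfolding regular_partition_def
proof (intro conjI ballI partition_on_singleton_partition)
  fix P x y
  assume "P \<in> singleton_partition W" "x \<in> P" "y \<in> P"
  then show "desc x = desc y"
    by (auto simp: singleton_partition_def)
next
  fix P x s
  assume P: "P \<in> singleton_partition W" "x \<in> P" and s: "s \<in> S - desc x"
  then have "x \<in> carrier W" "P = {x}"
    by (auto simp: singleton_partition_def)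
  then have "s <# P \<subseteq> {s \<otimes> x}" "{s \<otimes> x} \<in> singleton_partition W"
    using s by (auto simp: singleton_partition_def l_coset_def)
  then show "\<exists>Q\<in>singleton_partition W. s <# P \<subseteq> Q"
    by blast
qed

lemma singleton_partition_refines:
  "partition_on (carrier W) \<P> \<Longrightarrow> refines (carrier W) (singleton_partition W) \<P>"
  using partition_on_singleton_partition partition_onD1[of "carrier W" \<P>]
  by (auto simp: refines_def singleton_partition_def)

text \<open>Any one member of \<open>\<C>\<close> already fixes the descents on \<open>P\<close>.
  For the second condition, each member supplies a part containing \<open>s <# P\<close>, and the
  intersection of these parts is the required one.\<close>

lemma regular_common_refinement:
  assumes "\<C> \<noteq> {}" and reg: "\<And>\<P>. \<P> \<in> \<C> \<Longrightarrow> regular_partition W S \<P>"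
  shows "regular_partition W S (common_refinement \<C>)"
  unfolding regular_partition_def
proof (intro conjI ballI)
  show part: "partition_on (carrier W) (common_refinement \<C>)"
    by (rule partition_on_common_refinement[OF regular_partition_D1[OF reg] assms(1)])
  show "desc x = desc y" if Pxy: "P \<in> common_refinement \<C>" "x \<in> P" "y \<in> P" for P x y
  proof -
    obtain \<P> where "\<P> \<in> \<C>"
      using assms(1) by blast
    moreover obtain Q where "Q \<in> \<P>" "P \<subseteq> Q"
      using common_refinement_exists[OF Pxy(1) \<open>\<P> \<in> \<C>\<close>] by blast
    ultimately show ?thesis
      using regular_partition_D2[OF reg] Pxy(2,3) by blast
  qed
  fix P x s
  assume P: "P \<in> common_refinement \<C>" "x \<in> P" and s: "s \<in> S - desc x"
  have "\<exists>R\<in>\<P>. s <# P \<subseteq> R" if mem: "\<P> \<in> \<C>" for \<P>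
  proof -
    obtain Q where Q: "Q \<in> \<P>" "P \<subseteq> Q"
      using common_refinement_exists[OF P(1) mem] by blast
    then obtain R where "R \<in> \<P>" "s <# Q \<subseteq> R"
      using regular_partition_D3[OF reg[OF mem]] P(2) s by blast
    then show ?thesis
      using Q(2) by (auto simp: l_coset_def)
  qed
  then obtain F where F: "\<And>\<P>. \<P> \<in> \<C> \<Longrightarrow> F \<P> \<in> \<P> \<and> s <# P \<subseteq> F \<P>"
    by metis
  then have sub: "s <# P \<subseteq> \<Inter> (F ` \<C>)"
    by blast
  \<comment> \<open>Parts of a common refinement are the nonempty intersections; this element
    witnesses nonemptiness.\<close>
  moreover have "s \<otimes> x \<in> s <# P"
    using P(2) by (auto simp: l_coset_def)
  ultimately have "\<Inter> (F ` \<C>) \<in> common_refinement \<C>"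
    using F by (auto simp: common_refinement)
  then show "\<exists>R\<in>common_refinement \<C>. s <# P \<subseteq> R"
    using sub by blast
qed

section \<open>The lattice of regular partitions\<close>

lemma partial_order_regular_partitions: "partial_order (regular_partitions W S)"
  by unfold_locales
    (auto simp: regular_partitions_def regular_partition_D1
      intro: refines_refl refines_trans dest: refines_asym)

lemma least_cone_type_partition:
  "least (regular_partitions W S) (cone_type_partition W S) (carrier (regular_partitions W S))"
  by (simp add: least_def regular_partitions_def regular_cone_type_partition
      regular_refines_cone_type_partition)

lemma greatest_singleton_partition:
  "greatest (regular_partitions W S) (singleton_partition W) (carrier (regular_partitions W S))"
  by (simp add: greatest_def regular_partitions_def regular_singleton_partition
      singleton_partition_refines regular_partition_D1)

text \<open>Finer means larger, so a common refinement is an upper bound, and being the coarsest one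
  makes it the join.\<close>

lemma least_common_refinement:
  assumes "\<C> \<subseteq> carrier (regular_partitions W S)" "\<C> \<noteq> {}"
  shows "least (regular_partitions W S) (common_refinement \<C>) (Upper (regular_partitions W S) \<C>)"
proof -
  have reg: "regular_partition W S \<P>" if "\<P> \<in> \<C>" for \<P>
    using assms(1) that by (auto simp: regular_partitions_def)
  note part = regular_partition_D1[OF reg]
  have "refines (carrier W) (common_refinement \<C>) \<P>" if "\<P> \<in> \<C>" for \<P>
    using part that by (rule refines_common_refinement)
  moreover have "refines (carrier W) \<R> (common_refinement \<C>)"
    if "regular_partition W S \<R>" "\<forall>\<P>\<in>\<C>. refines (carrier W) \<R> \<P>" for \<R>
    using part regular_partition_D1[OF that(1)] that(2)
    by (intro common_refinement_coarsest) (auto simp: assms(2))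
  moreover have "\<C> \<inter> {\<P>. regular_partition W S \<P>} = \<C>"
    using reg by blast
  ultimately show ?thesis
    using regular_common_refinement[OF assms(2) reg]
    by (simp add: least_def Upper_def regular_partitions_def Ball_def)
qed

text \<open>Joins of nonempty families together with a bottom suffice: a meet is the join of all
  lower bounds, a family that contains the bottom. The criterion is stated for infima and a top,
  hence the passage to the dual order and back.\<close>

lemma complete_lattice_regular_partitions: "complete_lattice (regular_partitions W S)"
proof -
  interpret partial_order "regular_partitions W S"
    by (rule partial_order_regular_partitions)
  have "complete_lattice (inv_gorder (regular_partitions W S))"
    using least_cone_type_partition least_common_refinement
    by (intro partial_order.complete_lattice_criterion1[OF dual_order]) auto
  then interpret dual: complete_lattice "inv_gorder (regular_partitions W S)" .
  show ?thesis
    using dual.sup_exists dual.inf_exists by unfold_locales auto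
qed

end

theorem theorem3:
  fixes W :: "('a, 'b) monoid_scheme" and S :: "'a set"
  assumes "coxeter_system W S" and "finite S"
  shows "complete_lattice (regular_partitions W S) \<and>
    least (regular_partitions W S) (cone_type_partition W S) (carrier (regular_partitions W S)) \<and>
    greatest (regular_partitions W S) (singleton_partition W) (carrier (regular_partitions W S))"
proof -
  have "group W"
    using assms(1) by (auto simp: coxeter_system_def has_presentation_def)
  then interpret coxeter_group W S
    using assms(1) by (simp add: coxeter_group_def coxeter_group_axioms_def)
  show ?thesis
    using complete_lattice_regular_partitions least_cone_type_partition
      greatest_singleton_partition by blast
qed

end
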